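(* Let $d=d(n)\in(0,1/2)$ (not necessarily constant), let $H=H_n\in\mathcal{G}(n,d)$, and let $\alpha=\alpha(H)$ be the independence number of $H$. Suppose that $1\le\alpha<d^2n/2$ (and so $d>n^{-1/2}$). Let $G=H+R$, where $R$ is a uniformly random set of $m=m(n)$ edges chosen from $\overline{E}=[n]^{(2)}\setminus E(H)$. If $$\frac{md^3}{\ln d^{-1}}\to\infty\quad\text{as } n\to\infty,$$ then $G$ is Hamiltonian whp.
   Context: Graphs are finite and simple. $[n]=\{1,\dots,n\}$ and $[n]^{(2)}$ is the set of all 2-element subsets of $[n]$. $\mathcal{G}(n,d)$ denotes the set of graphs with vertex set $[n]$ whose minimum degree is at least $dn$. For a graph $H$ on $[n]$ and a set $R$ of edges, $H+R$ is the graph on $[n]$ with edge set $E(H)\cup R$. It is implicit that $0\le m\le|\overline{E}|$, so that a set $R\subseteq\overline{E}$ with $|R|=m$ exists. A sequence of events $\mathcal{E}_n$ occurs "with high probability" (whp) if $\lim_{n\to\infty}\Pr(\mathcal{E}_n)=1$. A graph is Hamiltonian if it contains a cycle through all its vertices. *)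

theory Defs
  imports "HOL-Library.Ramsey" "HOL-Probability.Probability"
begin

text \<open>A finite simple graph on the vertex set \<open>V\<close> is represented by its edge set
  \<open>E \<subseteq> [V]\<^bsup>2\<^esup>\<close>, where \<open>[V]\<^bsup>k\<^esup>\<close> is the library's set of all \<open>k\<close>-element subsets of \<open>V\<close>.
  With this representation the graph \<open>H + R\<close> on the vertex set of \<open>H\<close> is \<open>H \<union> R\<close>.\<close>

definition degree :: "'a set set \<Rightarrow> 'a \<Rightarrow> nat" where
  "degree E v = card {e \<in> E. v \<in> e}"

text \<open>Only meaningful for finite nonempty \<open>V\<close>.\<close>

definition min_degree :: "'a set \<Rightarrow> 'a set set \<Rightarrow> nat" where
  "min_degree V E = Min (degree E ` V)"

definition independence_number :: "'a set \<Rightarrow> 'a set set \<Rightarrow> nat" where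
  "independence_number V E = Max {card S | S. S \<subseteq> V \<and> indep S E}"

definition graphs_min_degree :: "nat \<Rightarrow> real \<Rightarrow> nat set set set" where
  "graphs_min_degree n d =
     {E. E \<subseteq> [{1..n}]\<^bsup>2\<^esup> \<and> real (min_degree {1..n} E) \<ge> d * real n}"

definition non_edges :: "'a set \<Rightarrow> 'a set set \<Rightarrow> 'a set set" where
  "non_edges V E = [V]\<^bsup>2\<^esup> - E"

text \<open>A cycle is given by the list of its distinct vertices in cyclic order; the first vertex is
  not repeated at the end.\<close>

definition is_cycle :: "'a set set \<Rightarrow> 'a list \<Rightarrow> bool" where
  "is_cycle E vs \<longleftrightarrow> length vs \<ge> 3 \<and> distinct vs \<and>
     (\<forall>i < length vs. {vs ! i, vs ! (Suc i mod length vs)} \<in> E)"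

definition hamiltonian :: "'a set \<Rightarrow> 'a set set \<Rightarrow> bool" where
  "hamiltonian V E \<longleftrightarrow> (\<exists>vs. is_cycle E vs \<and> set vs = V)"

text \<open>The uniform distribution on the \<open>m\<close>-element sets of non-edges. It is only meaningful if
  \<open>m \<le> card (non_edges V E)\<close>, as otherwise there is no such set.\<close>

definition random_edges :: "'a set \<Rightarrow> 'a set set \<Rightarrow> nat \<Rightarrow> 'a set set pmf" where
  "random_edges V E m = pmf_of_set ([non_edges V E]\<^bsup>m\<^esup>)"

definition whp :: "(nat \<Rightarrow> 'a pmf) \<Rightarrow> (nat \<Rightarrow> 'a \<Rightarrow> bool) \<Rightarrow> bool" where
  "whp M P \<longleftrightarrow> (\<lambda>n. measure_pmf.prob (M n) {x. P n x}) \<longlonglongrightarrow> 1"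

end

theory Submission
  imports Defs
begin

text \<open>
  Measure how far a graph \<open>F\<close> on \<open>V\<close> is from being Hamiltonian by its deficiency: the least number
  of consecutive pairs that are not edges of \<open>F\<close>, over all cyclic orderings of \<open>V\<close>. Call such a
  pair a gap. The deficiency never increases when edges are added, and \<open>F\<close> is Hamiltonian as soon
  as it is \<open>0\<close>. Three facts about it give the theorem.

  Few gaps at the start (lemma \<open>deficiency_less\<close>). Take an ordering of \<open>H\<close> with fewest gaps and let
  \<open>x\<close> and \<open>y\<close> be the vertices just after two of its gaps. If \<open>x\<close> and \<open>y\<close> had more than
  \<open>\<alpha>\<close> common neighbours, then two of the predecessors of these neighbours would be adjacent, and
  after cuts at the two gaps and before the two neighbours the ordering could be reassembled with one
  gap fewer. So the neighbourhoods of the vertices after gaps overlap pairwise in at most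
  \<open>\<alpha> < d\<^sup>2n/2\<close> vertices, while each has at least \<open>dn\<close> elements. By Bonferroni's inequality, only
  fewer than \<open>2/d\<close> such sets fit into \<open>n\<close> vertices.

  Many useful edges at every later stage (lemma \<open>many_boosters\<close>). In a graph of positive deficiency
  whose degrees are at least \<open>D\<close>, fix a gap of an optimal ordering, read the ordering as a path from
  one side of the gap to the other, and rotate the path at both ends: for every neighbour of the
  first and every neighbour of the last vertex, joining the ends of the rotated path closes the gap.
  This gives at least \<open>D\<^sup>2/2\<close> edges whose addition lowers the deficiency.

  Waiting time (lemma \<open>random_hitting_bound\<close>). Add the random edges one at a time. As long as the
  graph has positive deficiency, the next edge lowers it with probability at least
  \<open>(dn)\<^sup>2/2\<close> divided by \<open>n\<^sup>2/2\<close>, that is \<open>d\<^sup>2\<close>. So the expected number of steps before deficiency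
  \<open>0\<close> is at most \<open>(2/d)/d\<^sup>2\<close>, and by Markov's inequality the probability that \<open>m\<close> edges do not
  suffice is at most \<open>2/(md\<^sup>3)\<close>, which tends to \<open>0\<close>.
\<close>

section \<open>Gaps of a sequence of vertices\<close>

text \<open>A gap is recorded by its second vertex. This is what the counting below needs: in a cyclic
  ordering the recorded vertices are distinct, and their neighbourhoods can be compared.\<close>

fun gaps :: "'a set set \<Rightarrow> 'a list \<Rightarrow> 'a list" where
  "gaps F (x # y # zs) = (if {x, y} \<in> F then gaps F (y # zs) else y # gaps F (y # zs))"
| "gaps F _ = []"

text \<open>Prepending the last vertex turns the wrap-around pair of a cyclic ordering into an ordinary
  consecutive pair.\<close>
abbreviation closed_gaps :: "'a set set \<Rightarrow> 'a list \<Rightarrow> 'a list" where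
  "closed_gaps F vs \<equiv> gaps F (last vs # vs)"

text \<open>The contribution of a single join to the number of gaps. Written out, the number of gaps of a
  concatenation is a sum over the parts and the joins between them, so reassembling a cyclic
  ordering from its parts only changes the joins.\<close>
abbreviation gap :: "'a set set \<Rightarrow> 'a \<Rightarrow> 'a \<Rightarrow> nat" where
  "gap F x y \<equiv> (if {x, y} \<in> F then 0 else 1)"

lemma set_gaps_subset: "set (gaps F (x # xs)) \<subseteq> set xs"
  by (induction xs arbitrary: x) auto

lemma distinct_gaps: "distinct xs \<Longrightarrow> distinct (gaps F (x # xs))"
proof (induction xs arbitrary: x)
  case (Cons y ys)
  then show ?case
    using set_gaps_subset[of F y ys] by auto
qed simp

lemma gaps_append: "gaps F (x # xs @ ys) = gaps F (x # xs) @ gaps F (last (x # xs) # ys)"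
  by (induction xs arbitrary: x) auto

lemma length_gaps_Cons:
  "xs \<noteq> [] \<Longrightarrow> length (gaps F (x # xs)) = gap F x (hd xs) + length (gaps F xs)"
  by (cases xs) auto

lemma length_gaps_append:
  assumes "xs \<noteq> []" "ys \<noteq> []"
  shows "length (gaps F (xs @ ys)) = length (gaps F xs) + gap F (last xs) (hd ys) + length (gaps F ys)"
proof -
  obtain x xs' where xs: "xs = x # xs'"
    using assms(1) by (cases xs) auto
  show ?thesis
    unfolding xs append_Cons gaps_append length_append length_gaps_Cons[OF assms(2)] by simp
qed

lemma length_gaps_rev: "length (gaps F (rev xs)) = length (gaps F xs)"
proof (induction xs)
  case (Cons x xs)
  show ?case
  proof (cases "xs = []")
    case False
    then have "length (gaps F (rev xs @ [x])) =
        length (gaps F (rev xs)) + gap F (last (rev xs)) x + length (gaps F [x])"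
      by (subst length_gaps_append) auto
    then show ?thesis
      using Cons False by (simp add: length_gaps_Cons last_rev insert_commute)
  qed simp
qed simp

lemma gaps_antimono: "F \<subseteq> F' \<Longrightarrow> length (gaps F' xs) \<le> length (gaps F xs)"
  by (induction F xs rule: gaps.induct) auto

lemma closed_gaps_rotate:
  assumes "xs \<noteq> []" "ys \<noteq> []"
  shows "length (closed_gaps F (xs @ ys)) = length (closed_gaps F (ys @ xs))"
    and "set (closed_gaps F (xs @ ys)) = set (closed_gaps F (ys @ xs))"
  using assms by (auto simp: gaps_append)

lemma gaps_obtain:
  assumes "x \<in> set (gaps F (p # xs))"
  obtains A B where "xs = A @ x # B" "{last (p # A), x} \<notin> F"
  using assms
proof (induction xs arbitrary: p thesis)
  case (Cons y ys)
  show ?case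
  proof (cases "x = y \<and> {p, y} \<notin> F")
    case True
    then show ?thesis
      using Cons.prems(1)[of "[]" ys] by simp
  next
    case False
    with Cons.prems(2) have "x \<in> set (gaps F (y # ys))"
      by (auto split: if_splits)
    then obtain A B where "ys = A @ x # B" "{last (y # A), x} \<notin> F"
      using Cons.IH by blast
    then show ?thesis
      using Cons.prems(1)[of "y # A" B] by simp
  qed
qed simp

lemma gaps_empty_imp_edge:
  "gaps F xs = [] \<Longrightarrow> Suc i < length xs \<Longrightarrow> {xs ! i, xs ! Suc i} \<in> F"
proof (induction F xs arbitrary: i rule: gaps.induct)
  case (1 F x y zs)
  then show ?case
    by (cases i) (auto split: if_splits)
qed auto

lemma is_cycle_if_no_closed_gaps:
  assumes "distinct vs" "3 \<le> length vs" "closed_gaps F vs = []"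
  shows "is_cycle F vs"
  unfolding is_cycle_def
proof (intro conjI allI impI)
  fix i assume i: "i < length vs"
  show "{vs ! i, vs ! (Suc i mod length vs)} \<in> F"
  proof (cases "Suc i < length vs")
    case True
    then show ?thesis
      using gaps_empty_imp_edge[OF assms(3), of "Suc i"] by simp
  next
    case False
    with i have "Suc i = length vs" by simp
    moreover from this have "last vs = vs ! i"
      using i by (metis diff_Suc_1 last_conv_nth list.size(3) not_less_zero)
    ultimately show ?thesis
      using gaps_empty_imp_edge[OF assms(3), of 0] i by fastforce
  qed
qed (use assms in auto)

section \<open>The deficiency of a graph\<close>

definition orderings :: "'a set \<Rightarrow> 'a list set" where
  "orderings V = {vs. distinct vs \<and> set vs = V}"

text \<open>Equivalently, the least number of edges whose addition makes the graph Hamiltonian (for at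
  least three vertices).\<close>
definition deficiency :: "'a set \<Rightarrow> 'a set set \<Rightarrow> nat" where
  "deficiency V F = (LEAST t. \<exists>vs\<in>orderings V. t = length (closed_gaps F vs))"

lemma deficiency_le: "vs \<in> orderings V \<Longrightarrow> deficiency V F \<le> length (closed_gaps F vs)"
  unfolding deficiency_def by (rule Least_le) blast

lemma deficiency_obtain:
  assumes "finite V"
  obtains vs where "vs \<in> orderings V" "length (closed_gaps F vs) = deficiency V F"
proof -
  obtain ws where "ws \<in> orderings V"
    using finite_distinct_list[OF assms] by (auto simp: orderings_def)
  then have "\<exists>t. \<exists>vs\<in>orderings V. t = length (closed_gaps F vs)"
    by blast
  from LeastI_ex[OF this] show ?thesis
    using that unfolding deficiency_def by metis
qed

lemma deficiency_antimono:
  assumes "finite V" "F \<subseteq> F'"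
  shows "deficiency V F' \<le> deficiency V F"
proof -
  obtain vs where "vs \<in> orderings V" "length (closed_gaps F vs) = deficiency V F"
    using deficiency_obtain[OF assms(1)] .
  then show ?thesis
    using deficiency_le[of vs V F'] gaps_antimono[OF assms(2), of "last vs # vs"] by simp
qed

lemma hamiltonian_if_deficiency_0:
  assumes "finite V" "3 \<le> card V" "deficiency V F = 0"
  shows "hamiltonian V F"
proof -
  obtain vs where "vs \<in> orderings V" "closed_gaps F vs = []"
    using deficiency_obtain[OF assms(1), of F] assms(3) by auto
  moreover from this have "length vs = card V"
    by (auto simp: orderings_def distinct_card)
  ultimately have "is_cycle F vs" "set vs = V"
    using assms(2) by (auto simp: orderings_def intro!: is_cycle_if_no_closed_gaps)
  then show ?thesis
    unfolding hamiltonian_def by blast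
qed

text \<open>A gap may be moved to the wrap-around position, so that the ordering becomes a path whose ends
  are the two sides of the gap.\<close>
lemma rotate_to_gap:
  assumes "vs \<in> orderings V" "x \<in> set (closed_gaps F vs)"
  obtains us where "us \<in> orderings V" "us \<noteq> []" "hd us = x" "{last us, hd us} \<notin> F"
    "length (closed_gaps F us) = length (closed_gaps F vs)"
    "set (closed_gaps F us) = set (closed_gaps F vs)"
proof -
  obtain A B where AB: "vs = A @ x # B" "{last (last vs # A), x} \<notin> F"
    using gaps_obtain[OF assms(2)] .
  show ?thesis
  proof (rule that[of "x # B @ A"])
    show "x # B @ A \<in> orderings V"
      using assms(1) AB by (auto simp: orderings_def)
    show "{last (x # B @ A), hd (x # B @ A)} \<notin> F"
      using AB by (auto split: if_splits)
    show "length (closed_gaps F (x # B @ A)) = length (closed_gaps F vs)"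
      "set (closed_gaps F (x # B @ A)) = set (closed_gaps F vs)"
      using closed_gaps_rotate[of "x # B" A F] AB(1) by (cases "A = []"; simp)+
  qed auto
qed

section \<open>Cutting and reassembling a cyclic ordering\<close>

lemma split_at_two:
  assumes "0 < i" "i < j" "j < length us"
  obtains A B C where "us = A @ B @ C" "A \<noteq> []" "B \<noteq> []" "C \<noteq> []"
    "hd A = hd us" "last A = us ! (i - 1)" "hd B = us ! i" "last B = us ! (j - 1)"
    "hd C = us ! j" "last C = last us"
proof
  show "us = take i us @ take (j - i) (drop i us) @ drop j us"
    using assms by (metis add_diff_inverse_nat append.assoc append_take_drop_id not_less_iff_gr_or_eq take_add)
  show "last (take i us) = us ! (i - 1)"
    using assms by (subst last_conv_nth) auto
  show "last (take (j - i) (drop i us)) = us ! (j - 1)"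
    using assms by (subst last_conv_nth) auto
qed (use assms in \<open>auto simp: hd_drop_conv_nth hd_conv_nth last_drop\<close>)

lemma split_at_three:
  assumes "0 < i" "i < j" "j < k" "k < length us"
  obtains A B C D where "us = A @ B @ C @ D" "A \<noteq> []" "B \<noteq> []" "C \<noteq> []" "D \<noteq> []"
    "hd A = hd us" "last A = us ! (i - 1)" "hd B = us ! i" "last B = us ! (j - 1)"
    "hd C = us ! j" "last C = us ! (k - 1)" "hd D = us ! k" "last D = last us"
proof -
  have us: "us = take i us @ take (j - i) (drop i us) @ drop j us"
    using assms by (metis add_diff_inverse_nat append.assoc append_take_drop_id not_less_iff_gr_or_eq take_add)
  show ?thesis
  proof
    show "us = take i us @ take (j - i) (drop i us) @ take (k - j) (drop j us) @ drop k us"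
      using assms us by (metis add_diff_inverse_nat append_take_drop_id drop_drop add.commute not_less_iff_gr_or_eq)
    show "last (take i us) = us ! (i - 1)"
      using assms by (subst last_conv_nth) auto
    show "last (take (j - i) (drop i us)) = us ! (j - 1)"
      using assms by (subst last_conv_nth) auto
    show "last (take (k - j) (drop j us)) = us ! (k - 1)"
      using assms by (subst last_conv_nth) auto
  qed (use assms in \<open>auto simp: hd_drop_conv_nth hd_conv_nth last_drop\<close>)
qed

lemmas closed_gaps_concat =
  length_gaps_Cons length_gaps_append length_gaps_rev hd_append last_append hd_rev last_rev

text \<open>The two double rotations of a path \<open>A @ B @ C\<close> whose ends \<open>hd A\<close> and \<open>last C\<close> are the sides
  of a gap. Each end uses an edge to a neighbour on the path, and the two vertices left dangling are
  joined by the new edge. When the neighbour \<open>hd B\<close> of the first end comes no later than the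
  neighbour \<open>last B\<close> of the last end, the outer parts are reversed; when it comes later (as
  \<open>hd C\<close>, with \<open>hd B\<close> the neighbour of the last end), the last two parts are reversed.\<close>
lemma reconnect_ends_nested:
  assumes "A \<noteq> []" "B \<noteq> []" "C \<noteq> []" "{last C, hd A} \<notin> F"
    and "{hd A, hd B} \<in> F" "{last B, last C} \<in> F"
  shows "length (closed_gaps (insert {last A, hd C} F) (rev A @ B @ rev C))
    < length (closed_gaps F (A @ B @ C))"
proof -
  have "length (gaps (insert {last A, hd C} F) xs) \<le> length (gaps F xs)" for xs
    by (rule gaps_antimono) auto
  from this[of A] this[of B] this[of C] show ?thesis
    using assms by (simp add: closed_gaps_concat insert_commute)
qed

lemma reconnect_ends_crossed:
  assumes "A \<noteq> []" "B \<noteq> []" "C \<noteq> []" "{last C, hd A} \<notin> F"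
    and "{hd A, hd C} \<in> F" "{hd B, last C} \<in> F"
  shows "length (closed_gaps (insert {last B, last A} F) (A @ rev B @ rev C))
    < length (closed_gaps F (A @ B @ C))"
proof -
  have "length (gaps (insert {last B, last A} F) xs) \<le> length (gaps F xs)" for xs
    by (rule gaps_antimono) auto
  from this[of A] this[of B] this[of C] show ?thesis
    using assms by (simp add: closed_gaps_concat insert_commute)
qed

text \<open>The two ways of removing a gap without a new edge. The starts of two gaps are joined to
  two further part starts \<open>y\<close>, \<open>z\<close>, the predecessors of \<open>y\<close> and \<open>z\<close> are joined to each
  other, and the predecessors of the two starts become neighbours, possibly leaving a gap there. Which
  start is matched with which of \<open>y\<close>, \<open>z\<close> depends on the cyclic order: a wrong matching would
  produce two cycles. The two gaps are cyclically adjacent cuts in one case and alternate with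
  \<open>y\<close>, \<open>z\<close> in the other.\<close>
lemma reconnect_adjacent:
  assumes "A \<noteq> []" "B \<noteq> []" "C \<noteq> []" "D \<noteq> []"
    and "{last D, hd A} \<notin> F" "{last A, hd B} \<notin> F"
    and "{hd A, hd C} \<in> F" "{hd B, hd D} \<in> F" "{last B, last C} \<in> F"
  shows "length (closed_gaps F (A @ rev D @ B @ rev C)) < length (closed_gaps F (A @ B @ C @ D))"
  using assms by (simp add: closed_gaps_concat insert_commute)

lemma reconnect_alternating:
  assumes "A \<noteq> []" "B \<noteq> []" "C \<noteq> []" "D \<noteq> []"
    and "{last D, hd A} \<notin> F" "{last B, hd C} \<notin> F"
    and "{hd A, hd B} \<in> F" "{hd C, hd D} \<in> F" "{last A, last C} \<in> F"
  shows "length (closed_gaps F (A @ rev C @ D @ rev B)) < length (closed_gaps F (A @ B @ C @ D))"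
  using assms by (simp add: closed_gaps_concat insert_commute)

section \<open>Many edges lower the deficiency\<close>

lemma card_ordered_pairs_le:
  assumes "finite B" "B \<subseteq> [V]\<^bsup>2\<^esup>"
  shows "finite {(u, w). {u, w} \<in> B}" "card {(u, w). {u, w} \<in> B} \<le> 2 * card B"
proof -
  have *: "finite {(u, w). {u, w} = e} \<and> card {(u, w). {u, w} = e} \<le> 2" if "e \<in> B" for e
  proof -
    obtain x y where "e = {x, y}" using assms(2) \<open>e \<in> B\<close> nsets2_E by blast
    then have sub: "{(u, w). {u, w} = e} \<subseteq> {(x, y), (y, x)}"
      by (auto simp: doubleton_eq_iff)
    have "card {(u, w). {u, w} = e} \<le> card {(x, y), (y, x)}"
      by (rule card_mono[OF _ sub]) simp
    then show ?thesis
      using finite_subset[OF sub] card_insert_le_m1[of 2 "{(y, x)}" "(x, y)"] by simp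
  qed
  have eq: "{(u, w). {u, w} \<in> B} = (\<Union>e\<in>B. {(u, w). {u, w} = e})"
    by auto
  show "finite {(u, w). {u, w} \<in> B}"
    unfolding eq using * assms(1) by blast
  have "card (\<Union>e\<in>B. {(u, w). {u, w} = e}) \<le> (\<Sum>e\<in>B. card {(u, w). {u, w} = e})"
    by (rule card_UN_le[OF assms(1)])
  also have "\<dots> \<le> (\<Sum>e\<in>B. 2)"
    using * by (intro sum_mono) blast
  finally show "card {(u, w). {u, w} \<in> B} \<le> 2 * card B"
    unfolding eq by simp
qed

lemma card_positions:
  assumes "distinct us"
  shows "card {i. i < length us \<and> P (us ! i)} = card {w \<in> set us. P w}"
proof -
  have "(!) us ` {i. i < length us \<and> P (us ! i)} = {w \<in> set us. P w}"
    by (auto simp: in_set_conv_nth)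
  moreover have "inj_on ((!) us) {i. i < length us \<and> P (us ! i)}"
    using assms by (auto simp: inj_on_def nth_eq_iff_index_eq)
  ultimately show ?thesis
    by (metis card_image)
qed

text \<open>Since adding an edge of \<open>F\<close> changes nothing, a booster is automatically a non-edge of \<open>F\<close>.\<close>
definition boosters :: "'a set \<Rightarrow> 'a set set \<Rightarrow> 'a set set" where
  "boosters V F = {e \<in> [V]\<^bsup>2\<^esup>. deficiency V (insert e F) < deficiency V F}"

text \<open>Positions \<open>i\<close> of neighbours of the first vertex and \<open>j\<close> of neighbours of the last vertex of
  the path determine a double rotation and hence a booster. The pair \<open>(i, j)\<close> can be read off from
  the ordered ends of the booster, so that each booster arises at most twice.\<close>
lemma many_boosters:
  assumes V: "finite V" and F: "F \<subseteq> [V]\<^bsup>2\<^esup>" and pos: "0 < deficiency V F"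
    and deg: "\<And>v. v \<in> V \<Longrightarrow> D \<le> card {w \<in> V. {v, w} \<in> F}"
  shows "D * D \<le> 2 * card (boosters V F)"
proof -
  obtain vs where vs: "vs \<in> orderings V" "length (closed_gaps F vs) = deficiency V F"
    using deficiency_obtain[OF V] .
  with pos obtain x where "x \<in> set (closed_gaps F vs)"
    by (metis length_greater_0_conv last_in_set)
  then obtain us where us: "us \<in> orderings V" "us \<noteq> []" "hd us = x" "{last us, hd us} \<notin> F"
    and len: "length (closed_gaps F us) = length (closed_gaps F vs)"
      "set (closed_gaps F us) = set (closed_gaps F vs)"
    by (rule rotate_to_gap[OF vs(1)])
  define n where "n = length us"
  have dist: "distinct us" and set_us: "set us = V"
    using us(1) by (auto simp: orderings_def)
  have n: "0 < n" "last us = us ! (n - 1)" "hd us = us ! 0"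
    using us(2) by (auto simp: n_def last_conv_nth hd_conv_nth)
  have no_loop: "{v, v} \<notin> F" for v
    using F by (auto simp: nsets_def)
  define I where "I = {i. i < length us \<and> {hd us, us ! i} \<in> F}"
  define J where "J = {j. j < length us \<and> {last us, us ! j} \<in> F}"
  have I: "0 < i \<and> i < n - 1" if "i \<in> I" for i
  proof -
    have "i \<noteq> 0"
      using that no_loop n(3) unfolding I_def by (metis (mono_tags, lifting) mem_Collect_eq)
    moreover have "i \<noteq> n - 1"
      using that us(4) n(2) by (auto simp: I_def insert_commute)
    ultimately show ?thesis
      using that by (auto simp: I_def n_def)
  qed
  have J: "0 < j \<and> j < n - 1" if "j \<in> J" for j
  proof -
    have "j \<noteq> 0"
      using that us(4) n(3) unfolding J_def by (metis (mono_tags, lifting) mem_Collect_eq)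
    moreover have "j \<noteq> n - 1"
      using that no_loop n(2) unfolding J_def by (metis (mono_tags, lifting) mem_Collect_eq)
    ultimately show ?thesis
      using that by (auto simp: J_def n_def)
  qed
  \<comment> \<open>Rotating at \<open>i\<close> frees the predecessor of position \<open>i\<close>. It also reverses everything before \<open>i\<close>,
      so the vertex freed by \<open>j\<close> is the successor of position \<open>j\<close> if \<open>i \<le> j\<close> and the predecessor
      otherwise. Both exist, as \<open>i\<close> and \<open>j\<close> are interior positions.\<close>
  define f where "f = (\<lambda>(i::nat, j). (us ! (i - 1), us ! (if i \<le> j then j + 1 else j - 1)))"
  have booster: "{us ! (i - 1), us ! (if i \<le> j then j + 1 else j - 1)} \<in> boosters V F"
    if ij: "i \<in> I" "j \<in> J" for i j
  proof -
    define e where "e = {us ! (i - 1), us ! (if i \<le> j then j + 1 else j - 1)}"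
    have i: "0 < i" "i < n - 1" "{hd us, us ! i} \<in> F" and j: "0 < j" "j < n - 1" "{last us, us ! j} \<in> F"
      using I[OF ij(1)] J[OF ij(2)] ij by (auto simp: I_def J_def)
    have "\<exists>ws\<in>orderings V. length (closed_gaps (insert e F) ws) < length (closed_gaps F us)"
    proof (cases "i \<le> j")
      case True
      with i j have split: "i < j + 1" "j + 1 < length us"
        by (auto simp: n_def)
      obtain A B C where ABC: "us = A @ B @ C" "A \<noteq> []" "B \<noteq> []" "C \<noteq> []"
        "hd A = hd us" "last A = us ! (i - 1)" "hd B = us ! i" "last B = us ! (j + 1 - 1)"
        "hd C = us ! (j + 1)" "last C = last us"
        using split_at_two[OF i(1) split] .
      have "e = {last A, hd C}"
        using True ABC(5-10) by (simp add: e_def)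
      moreover have "rev A @ B @ rev C \<in> orderings V"
        using us(1) ABC(1) by (auto simp: orderings_def)
      moreover have "length (closed_gaps (insert {last A, hd C} F) (rev A @ B @ rev C))
          < length (closed_gaps F (A @ B @ C))"
        using us(4) i(3) j(3) ABC(2-10) by (intro reconnect_ends_nested) (simp_all add: insert_commute)
      ultimately show ?thesis
        using ABC(1) by auto
    next
      case False
      with i j have split: "j < i" "i < length us"
        by (auto simp: n_def)
      obtain A B C where ABC: "us = A @ B @ C" "A \<noteq> []" "B \<noteq> []" "C \<noteq> []"
        "hd A = hd us" "last A = us ! (j - 1)" "hd B = us ! j" "last B = us ! (i - 1)"
        "hd C = us ! i" "last C = last us"
        using split_at_two[OF j(1) split] .
      have "e = {last B, last A}"
        using False ABC(5-10) by (simp add: e_def)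
      moreover have "A @ rev B @ rev C \<in> orderings V"
        using us(1) ABC(1) by (auto simp: orderings_def)
      moreover have "length (closed_gaps (insert {last B, last A} F) (A @ rev B @ rev C))
          < length (closed_gaps F (A @ B @ C))"
        using us(4) i(3) j(3) ABC(2-10) by (intro reconnect_ends_crossed) (simp_all add: insert_commute)
      ultimately show ?thesis
        using ABC(1) by auto
    qed
    then have "deficiency V (insert e F) < deficiency V F"
      using deficiency_le[of _ V "insert e F"] len(1) vs(2) by fastforce
    moreover have "e \<in> [V]\<^bsup>2\<^esup>"
      using i j dist unfolding e_def set_us[symmetric]
      by (auto simp: nth_eq_iff_index_eq n_def)
    ultimately show ?thesis
      unfolding boosters_def e_def by blast
  qed
  have "inj_on f (I \<times> J)"
  proof (rule inj_onI; clarify)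
    fix i j i' j'
    assume ij: "i \<in> I" "j \<in> J" "i' \<in> I" "j' \<in> J" and eq: "f (i, j) = f (i', j')"
    have "i - 1 = i' - 1" "(if i \<le> j then j + 1 else j - 1) = (if i' \<le> j' then j' + 1 else j' - 1)"
      using eq dist I[OF ij(1)] I[OF ij(3)] J[OF ij(2)] J[OF ij(4)]
      by (auto simp: f_def nth_eq_iff_index_eq n_def split: if_splits)
    then show "i = i' \<and> j = j'"
      using I[OF ij(1)] I[OF ij(3)] J[OF ij(2)] J[OF ij(4)]
      by (auto split: if_splits)
  qed
  then have "card I * card J = card (f ` (I \<times> J))"
    by (simp add: card_image card_cartesian_product)
  also have "\<dots> \<le> card {(u, w). {u, w} \<in> boosters V F}"
  proof (rule card_mono)
    show "f ` (I \<times> J) \<subseteq> {(u, w). {u, w} \<in> boosters V F}"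
      using booster by (auto simp: f_def)
    show "finite {(u, w). {u, w} \<in> boosters V F}"
      using V by (intro card_ordered_pairs_le[of _ V])
        (auto simp: boosters_def finite_imp_finite_nsets)
  qed
  also have "\<dots> \<le> 2 * card (boosters V F)"
    using V by (intro card_ordered_pairs_le[of _ V])
      (auto simp: boosters_def finite_imp_finite_nsets)
  finally have "card I * card J \<le> 2 * card (boosters V F)" .
  moreover have "D \<le> card I" "D \<le> card J"
    using deg[of "hd us"] deg[of "last us"] us(2) set_us
      card_positions[OF dist, of "\<lambda>w. {hd us, w} \<in> F"]
      card_positions[OF dist, of "\<lambda>w. {last us, w} \<in> F"]
    by (auto simp: I_def J_def)
  ultimately show ?thesis
    using mult_le_mono[of D "card I" D "card J"] by linarith
qed

section \<open>The deficiency is small if the independence number is\<close>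

lemma card_le_independence_number:
  assumes "finite V" "S \<subseteq> V" "indep S E"
  shows "card S \<le> independence_number V E"
proof -
  have "{card S | S. S \<subseteq> V \<and> indep S E} = card ` {S. S \<subseteq> V \<and> indep S E}"
    by auto
  moreover have "finite \<dots>"
    using assms(1) by simp
  ultimately show ?thesis
    unfolding independence_number_def using assms by (intro Max_ge) auto
qed

text \<open>Two gaps whose second vertices have two common neighbours with adjacent predecessors can be
  merged into one. All four cuts are at different places, because a vertex is not its own neighbour.
  As both gap vertices see both neighbours, their roles are interchangeable; if the second gap
  comes after both neighbours, the cyclic ordering is read from the second gap on.\<close>
lemma merge_two_gaps:
  assumes us: "us \<in> orderings V" "us \<noteq> []" "{last us, hd us} \<notin> F"
    and F: "F \<subseteq> [V]\<^bsup>2\<^esup>"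
    and x: "x \<in> set (closed_gaps F us)" "x \<noteq> hd us"
    and ij: "0 < i" "i < j" "j < length us"
    and nbrs: "{hd us, us ! i} \<in> F" "{x, us ! i} \<in> F" "{hd us, us ! j} \<in> F" "{x, us ! j} \<in> F"
    and pred: "{us ! (i - 1), us ! (j - 1)} \<in> F"
  shows "deficiency V F < length (closed_gaps F us)"
proof -
  obtain P Q where PQ: "us = P @ x # Q" "{last (last us # P), x} \<notin> F"
    using gaps_obtain[OF x(1)] .
  define k where "k = length P"
  have "P \<noteq> []"
    using PQ x(2) by auto
  then have k: "0 < k" "k < length us" "us ! k = x" "{us ! (k - 1), us ! k} \<notin> F"
    using PQ unfolding k_def by (auto simp: nth_append last_conv_nth)
  have no_loop: "{v, v} \<notin> F" for v
    using F by (auto simp: nsets_def)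
  have "k \<noteq> i" "k \<noteq> j"
    using k(3) nbrs no_loop by auto
  then consider "k < i" | "i < k" "k < j" | "j < k"
    using ij(2) by linarith
  then have "\<exists>ws\<in>orderings V. length (closed_gaps F ws) < length (closed_gaps F us)"
  proof cases
    case 1
    obtain A B C D where ABCD: "us = A @ B @ C @ D" "A \<noteq> []" "B \<noteq> []" "C \<noteq> []" "D \<noteq> []"
      "hd A = hd us" "last A = us ! (k - 1)" "hd B = us ! k" "last B = us ! (i - 1)"
      "hd C = us ! i" "last C = us ! (j - 1)" "hd D = us ! j" "last D = last us"
      using split_at_three[OF k(1) 1 ij(2,3)] .
    have "A @ rev D @ B @ rev C \<in> orderings V"
      using us(1) ABCD(1) by (auto simp: orderings_def)
    moreover have "length (closed_gaps F (A @ rev D @ B @ rev C)) < length (closed_gaps F (A @ B @ C @ D))"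
      using us(3) k nbrs pred ABCD(2-13) by (intro reconnect_adjacent) simp_all
    ultimately show ?thesis
      using ABCD(1) by auto
  next
    case 2
    obtain A B C D where ABCD: "us = A @ B @ C @ D" "A \<noteq> []" "B \<noteq> []" "C \<noteq> []" "D \<noteq> []"
      "hd A = hd us" "last A = us ! (i - 1)" "hd B = us ! i" "last B = us ! (k - 1)"
      "hd C = us ! k" "last C = us ! (j - 1)" "hd D = us ! j" "last D = last us"
      using split_at_three[OF ij(1) 2 ij(3)] .
    have "A @ rev C @ D @ rev B \<in> orderings V"
      using us(1) ABCD(1) by (auto simp: orderings_def)
    moreover have "length (closed_gaps F (A @ rev C @ D @ rev B)) < length (closed_gaps F (A @ B @ C @ D))"
      using us(3) k nbrs pred ABCD(2-13) by (intro reconnect_alternating) simp_all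
    ultimately show ?thesis
      using ABCD(1) by auto
  next
    case 3
    obtain B C D A where ABCD: "us = B @ C @ D @ A" "B \<noteq> []" "C \<noteq> []" "D \<noteq> []" "A \<noteq> []"
      "hd B = hd us" "last B = us ! (i - 1)" "hd C = us ! i" "last C = us ! (j - 1)"
      "hd D = us ! j" "last D = us ! (k - 1)" "hd A = us ! k" "last A = last us"
      using split_at_three[OF ij(1,2) 3 k(2)] .
    have "A @ rev D @ B @ rev C \<in> orderings V"
      using us(1) ABCD(1) by (auto simp: orderings_def)
    moreover have "length (closed_gaps F (A @ rev D @ B @ rev C)) < length (closed_gaps F (A @ B @ C @ D))"
      using us(3) k nbrs pred ABCD(2-13) by (intro reconnect_adjacent) simp_all
    moreover have "length (closed_gaps F (A @ B @ C @ D)) = length (closed_gaps F us)"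
      using closed_gaps_rotate(1)[of A "B @ C @ D" F] ABCD(1,2,5) by simp
    ultimately show ?thesis
      by auto
  qed
  then show ?thesis
    using deficiency_le[of _ V F] by fastforce
qed

text \<open>In an optimal ordering no merging is possible, so the predecessors of the common neighbours
  form an independent set.\<close>
lemma common_neighbours_of_gaps_le:
  assumes V: "finite V" and F: "F \<subseteq> [V]\<^bsup>2\<^esup>"
    and vs: "vs \<in> orderings V" "length (closed_gaps F vs) = deficiency V F"
    and x: "x \<in> set (closed_gaps F vs)" "y \<in> set (closed_gaps F vs)" "x \<noteq> y"
  shows "card {w \<in> V. {x, w} \<in> F \<and> {y, w} \<in> F} \<le> independence_number V F"
proof -
  obtain us where us: "us \<in> orderings V" "us \<noteq> []" and hd: "hd us = x" and us3: "{last us, hd us} \<notin> F"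
    and len: "length (closed_gaps F us) = length (closed_gaps F vs)"
      "set (closed_gaps F us) = set (closed_gaps F vs)"
    by (rule rotate_to_gap[OF vs(1) x(1)])
  have y: "y \<in> set (closed_gaps F us)"
    using x(2) len(2) by simp
  have dist: "distinct us" and set_us: "set us = V"
    using us(1) by (auto simp: orderings_def)
  have no_loop: "{v, v} \<notin> F" for v
    using F by (auto simp: nsets_def)
  define I where "I = {i. i < length us \<and> {hd us, us ! i} \<in> F \<and> {y, us ! i} \<in> F}"
  have "i \<noteq> 0" if "i \<in> I" for i
  proof
    assume "i = 0"
    with that us(2) have "{hd us, hd us} \<in> F"
      by (simp add: I_def hd_conv_nth)
    with no_loop show False by blast
  qed
  then have I: "0 < i" "i < length us" if "i \<in> I" for i
    using that by (auto simp: I_def)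
  have ordered: "{us ! (i - 1), us ! (j - 1)} \<notin> F" if "i \<in> I" "j \<in> I" "i < j" for i j
    using merge_two_gaps[OF us us3 F y, of i j] that I[OF that(1)] x(3) hd len(1) vs(2)
    by (auto simp: I_def)
  have "indep ((\<lambda>i. us ! (i - 1)) ` I) F"
    unfolding indep_def
  proof clarify
    fix i j assume ij: "i \<in> I" "j \<in> I" "us ! (i - 1) \<noteq> us ! (j - 1)" "{us ! (i - 1), us ! (j - 1)} \<in> F"
    then consider "i < j" | "j < i"
      using nat_neq_iff by blast
    then show False
      using ordered[of i j] ordered[of j i] ij by cases (auto simp: insert_commute)
  qed
  moreover have "(\<lambda>i. us ! (i - 1)) ` I \<subseteq> V"
    using I by (auto simp: set_us[symmetric] intro!: nth_mem less_imp_diff_less)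
  ultimately have "card ((\<lambda>i. us ! (i - 1)) ` I) \<le> independence_number V F"
    by (intro card_le_independence_number[OF V])
  moreover have "inj_on (\<lambda>i. us ! (i - 1)) I"
  proof (rule inj_onI)
    fix i j assume ij: "i \<in> I" "j \<in> I" "us ! (i - 1) = us ! (j - 1)"
    then have "i - 1 = j - 1"
      using dist I[OF ij(1)] I[OF ij(2)] by (simp add: nth_eq_iff_index_eq)
    then show "i = j"
      using I[OF ij(1)] I[OF ij(2)] by linarith
  qed
  ultimately have "card I \<le> independence_number V F"
    by (simp add: card_image)
  then show ?thesis
    using card_positions[OF dist, of "\<lambda>w. {hd us, w} \<in> F \<and> {y, w} \<in> F"] set_us hd
    by (simp add: I_def)
qed

text \<open>Bonferroni's inequality for sets with uniform bounds: a set that is added to the union of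
  \<open>k\<close> others meets it in at most \<open>k * a\<close> elements, and these losses sum to the binomial term.\<close>
lemma bonferroni_uniform:
  assumes "finite S" "\<And>x. x \<in> S \<Longrightarrow> finite (N x)" "\<And>x. x \<in> S \<Longrightarrow> D \<le> card (N x)"
    and "\<And>x y. x \<in> S \<Longrightarrow> y \<in> S \<Longrightarrow> x \<noteq> y \<Longrightarrow> card (N x \<inter> N y) \<le> a"
  shows "D * card S \<le> card (\<Union>x\<in>S. N x) + a * (card S choose 2)"
  using assms
proof (induction S)
  case (insert x S)
  define U where "U = (\<Union>y\<in>S. N y)"
  have "card (N x \<inter> U) \<le> (\<Sum>y\<in>S. card (N x \<inter> N y))"
    unfolding U_def Int_UN_distrib by (rule card_UN_le[OF insert.hyps(1)])
  also have "\<dots> \<le> (\<Sum>y\<in>S. a)"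
    using insert.prems(3) insert.hyps(2) by (intro sum_mono) auto
  finally have "card (N x \<inter> U) \<le> a * card S"
    by (simp add: mult.commute)
  moreover have "card (N x) + card U = card (N x \<union> U) + card (N x \<inter> U)"
    using insert.prems(1) insert.hyps(1) by (intro card_Un_Int) (auto simp: U_def)
  moreover have "D * card S \<le> card U + a * (card S choose 2)"
    unfolding U_def using insert.IH insert.prems by auto
  moreover have "D \<le> card (N x)"
    using insert.prems(2) by simp
  ultimately have "D + D * card S \<le> card (N x \<union> U) + a * (card S + (card S choose 2))"
    by (simp add: algebra_simps)
  moreover have "(Suc (card S) choose 2) = card S + (card S choose 2)"
    by (simp add: numeral_2_eq_2)
  ultimately show ?case
    using insert.hyps by (simp add: U_def)
qed simp

lemma deficiency_bonferroni:
  assumes V: "finite V" and F: "F \<subseteq> [V]\<^bsup>2\<^esup>"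
    and deg: "\<And>v. v \<in> V \<Longrightarrow> D \<le> card {w \<in> V. {v, w} \<in> F}"
    and s: "s \<le> deficiency V F"
  shows "D * s \<le> card V + independence_number V F * (s choose 2)"
proof -
  obtain vs where vs: "vs \<in> orderings V" "length (closed_gaps F vs) = deficiency V F"
    using deficiency_obtain[OF V] .
  have dist: "distinct vs" and set_vs: "set vs = V"
    using vs(1) by (auto simp: orderings_def)
  have "card (set (closed_gaps F vs)) = deficiency V F"
    using distinct_gaps[OF dist] vs(2) by (simp add: distinct_card)
  then obtain S where S: "S \<subseteq> set (closed_gaps F vs)" "card S = s"
    using obtain_subset_with_card_n s by metis
  have SV: "S \<subseteq> V"
    using S(1) set_gaps_subset[of F "last vs" vs] set_vs by blast
  define N where "N = (\<lambda>v. {w \<in> V. {v, w} \<in> F})"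
  have "D * card S \<le> card (\<Union>x\<in>S. N x) + independence_number V F * (card S choose 2)"
  proof (rule bonferroni_uniform)
    show "finite S" using SV V finite_subset by blast
    show "card (N x \<inter> N y) \<le> independence_number V F" if "x \<in> S" "y \<in> S" "x \<noteq> y" for x y
    proof -
      have "N x \<inter> N y = {w \<in> V. {x, w} \<in> F \<and> {y, w} \<in> F}"
        by (auto simp: N_def)
      then show ?thesis
        using common_neighbours_of_gaps_le[OF V F vs, of x y] that S(1) by auto
    qed
  qed (use deg SV V in \<open>auto simp: N_def\<close>)
  moreover have "card (\<Union>x\<in>S. N x) \<le> card V"
    by (rule card_mono[OF V]) (auto simp: N_def)
  ultimately show ?thesis
    using S(2) by simp
qed

text \<open>Bonferroni's inequality is applied to \<open>s = \<lfloor>2/d\<rfloor>\<close> gaps. With \<open>x = ds\<close> it would give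
  \<open>x < 1 + x\<^sup>2/4 - xd/4\<close>, that is \<open>xd < (2 - x)\<^sup>2\<close>. But \<open>x\<close> is within \<open>d\<close> of \<open>2\<close>, so that the
  right-hand side is at most \<open>d\<^sup>2\<close>, which is less than \<open>xd\<close>. The bound \<open>d\<^sup>2n/2\<close> on the independence
  number is just what makes the square complete.\<close>
lemma deficiency_less:
  fixes d :: real
  assumes V: "finite V" and F: "F \<subseteq> [V]\<^bsup>2\<^esup>" and d: "0 < d" "d < 1 / 2"
    and deg: "\<And>v. v \<in> V \<Longrightarrow> D \<le> card {w \<in> V. {v, w} \<in> F}" and D: "d * card V \<le> D"
    and alpha: "independence_number V F < d\<^sup>2 * card V / 2"
  shows "deficiency V F < 2 / d"
proof (rule ccontr)
  assume neg: "\<not> deficiency V F < 2 / d"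
  define s where "s = nat \<lfloor>2 / d\<rfloor>"
  define n where "n = real (card V)"
  have s: "real s \<le> 2 / d" "2 / d - 1 < real s"
    using d by (simp_all add: s_def)
  have "4 < 2 / d"
    using d by (simp add: field_simps)
  with s have s3: "3 < real s" by linarith
  have n: "0 < n"
    using alpha d by (cases "n = 0") (auto simp: n_def)
  have "real s \<le> deficiency V F"
    using s(1) neg by linarith
  then have "D * s \<le> card V + independence_number V F * (s choose 2)"
    by (intro deficiency_bonferroni[OF V F deg]) auto
  then have "real D * s \<le> n + independence_number V F * real (s choose 2)"
    unfolding n_def by (metis of_nat_add of_nat_le_iff of_nat_mult)
  also have "real (s choose 2) = s * (real s - 1) / 2"
    using s3 by (simp add: choose_two real_of_nat_div of_nat_diff)
  finally have "real D * s \<le> n + independence_number V F * (s * (real s - 1) / 2)" .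
  moreover have "d * n * s \<le> real D * s"
    using D by (intro mult_right_mono) (auto simp: n_def)
  moreover have "independence_number V F * (s * (real s - 1) / 2)
      < (d\<^sup>2 * n / 2) * (s * (real s - 1) / 2)"
    using alpha s3 by (intro mult_strict_right_mono) (auto simp: n_def)
  ultimately have "d * n * s < n + (d\<^sup>2 * n / 2) * (s * (real s - 1) / 2)"
    by linarith
  then have "n * (d * s) < n * (1 + d\<^sup>2 * s * (real s - 1) / 4)"
    by (simp add: algebra_simps)
  then have "d * s < 1 + d\<^sup>2 * s * (real s - 1) / 4"
    using n by (simp add: mult_less_cancel_left_pos)
  moreover define x where "x = d * s"
  moreover have "1 + d\<^sup>2 * s * (real s - 1) / 4 = 1 + x * x / 4 - x * d / 4"
    by (simp add: x_def algebra_simps power2_eq_square diff_divide_distrib)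
  ultimately have "x < 1 + x * x / 4 - x * d / 4"
    by simp
  then have "x * d < (2 - x) * (2 - x)"
    by (simp add: algebra_simps)
  moreover have x: "x \<le> 2" "2 - d \<le> x"
    using s d by (simp_all add: x_def field_simps)
  have "(2 - x) * (2 - x) \<le> d * d"
    using x by (intro mult_mono) auto
  ultimately have "x * d < d * d"
    by linarith
  with d x show False
    by simp
qed

section \<open>Random sets reaching a target through many small steps\<close>

text \<open>A set of size \<open>k + 1\<close> arises from a \<open>k\<close>-set by adding an element in \<open>k + 1\<close> ways. Hence a
  uniformly random \<open>(k + 1)\<close>-set is a uniformly random \<open>k\<close>-set with a uniformly random further element.\<close>
lemma sum_insert_nsets:
  assumes "finite X"
  shows "(\<Sum>R\<in>[X]\<^bsup>k\<^esup>. \<Sum>e\<in>X - R. g (insert e R)) = real (Suc k) * (\<Sum>R\<in>[X]\<^bsup>Suc k\<^esup>. g R)"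
proof -
  have fin: "finite R" if "R \<subseteq> X" for R
    using that assms finite_subset by blast
  have "(\<Sum>R\<in>[X]\<^bsup>k\<^esup>. \<Sum>e\<in>X - R. g (insert e R))
      = (\<Sum>(R, e)\<in>(SIGMA R:[X]\<^bsup>k\<^esup>. X - R). g (insert e R))"
    using assms by (subst sum.Sigma) (auto simp: finite_imp_finite_nsets)
  also have "\<dots> = (\<Sum>(R, e)\<in>(SIGMA R:[X]\<^bsup>Suc k\<^esup>. R). g R)"
    by (rule sum.reindex_bij_witness[of _ "\<lambda>(R, e). (R - {e}, e)" "\<lambda>(R, e). (insert e R, e)"])
      (auto simp: nsets_def insert_absorb)
  also have "\<dots> = (\<Sum>R\<in>[X]\<^bsup>Suc k\<^esup>. \<Sum>e\<in>R. g R)"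
    using assms fin by (subst sum.Sigma) (auto simp: finite_imp_finite_nsets nsets_def)
  also have "\<dots> = (\<Sum>R\<in>[X]\<^bsup>Suc k\<^esup>. real (Suc k) * g R)"
    by (rule sum.cong) (auto simp: nsets_def)
  finally show ?thesis
    by (simp only: sum_distrib_left)
qed

text \<open>The expectation of \<open>g\<close> over a uniformly random \<open>k\<close>-subset of \<open>X\<close>.\<close>
definition nsets_mean :: "'a set \<Rightarrow> nat \<Rightarrow> ('a set \<Rightarrow> real) \<Rightarrow> real" where
  "nsets_mean X k g = (\<Sum>R\<in>[X]\<^bsup>k\<^esup>. g R) / real (card X choose k)"

text \<open>If \<open>h R\<close> bounds the conditional expectation of \<open>g\<close> after adding one random element to \<open>R\<close>,
  then the mean of \<open>g\<close> one step later is bounded by the mean of \<open>h\<close>.\<close>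
lemma nsets_mean_step:
  assumes "finite X" "k < card X"
    and le: "\<And>R. R \<in> [X]\<^bsup>k\<^esup> \<Longrightarrow> (\<Sum>e\<in>X - R. g (insert e R)) \<le> real (card X - k) * h R"
  shows "nsets_mean X (Suc k) g \<le> nsets_mean X k h"
proof -
  define N where "N = card X"
  have kN: "k < N"
    using assms(2) by (simp add: N_def)
  have "Suc k * (N choose Suc k) = (N - k) * (N choose k)"
    by (simp only: binomial_absorption binomial_absorb_comp)
  then have choose: "real (Suc k) * real (N choose Suc k) = real (N - k) * real (N choose k)"
    by (metis of_nat_mult)
  have pos: "0 < real (N choose k)" "0 < real (N choose Suc k)" "0 < real (N - k)"
    using kN by simp_all
  have "(\<Sum>R\<in>[X]\<^bsup>k\<^esup>. \<Sum>e\<in>X - R. g (insert e R)) \<le> (\<Sum>R\<in>[X]\<^bsup>k\<^esup>. real (N - k) * h R)"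
    unfolding N_def by (rule sum_mono) (rule le)
  then have "real (Suc k) * (\<Sum>R\<in>[X]\<^bsup>Suc k\<^esup>. g R) \<le> real (N - k) * (\<Sum>R\<in>[X]\<^bsup>k\<^esup>. h R)"
    by (simp only: sum_insert_nsets[OF assms(1)] sum_distrib_left)
  then have "real (Suc k) * (\<Sum>R\<in>[X]\<^bsup>Suc k\<^esup>. g R) / (real (Suc k) * real (N choose Suc k))
      \<le> real (N - k) * (\<Sum>R\<in>[X]\<^bsup>k\<^esup>. h R) / (real (N - k) * real (N choose k))"
    unfolding choose using pos by (intro divide_right_mono) simp_all
  then show ?thesis
    using pos(3) by (simp add: nsets_mean_def N_def del: of_nat_Suc of_nat_diff)
qed

text \<open>While \<open>f\<close> is positive, each step lowers it by at least \<open>1\<close> with probability at least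
  \<open>q / card X\<close>. The expected value of \<open>f\<close> starts at \<open>f {}\<close>, never becomes negative, and drops in step
  \<open>k\<close> by at least \<open>q / card X\<close> times the probability that \<open>f\<close> is still positive. That probability
  is nonincreasing in \<open>k\<close>, so \<open>m\<close> times its value at \<open>m\<close> is bounded by \<open>f {} * card X / q\<close>.\<close>
lemma random_hitting_bound:
  fixes f :: "'a set \<Rightarrow> nat" and q :: real
  assumes X: "finite X" and q: "0 \<le> q" and m: "m \<le> card X"
    and mono: "\<And>R e. R \<subseteq> X \<Longrightarrow> e \<in> X \<Longrightarrow> f (insert e R) \<le> f R"
    and boost: "\<And>R. R \<subseteq> X \<Longrightarrow> 0 < f R \<Longrightarrow> q \<le> card {e \<in> X. f (insert e R) < f R}"
  shows "q * m * measure_pmf.prob (pmf_of_set ([X]\<^bsup>m\<^esup>)) {R. 0 < f R} \<le> f {} * card X"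
proof -
  define N where "N = card X"
  define u where "u k = nsets_mean X k (\<lambda>R. real (f R))" for k
  define w where "w k = nsets_mean X k (\<lambda>R. of_bool (0 < f R))" for k
  have size: "R \<subseteq> X" "card (X - R) = N - k" if "R \<in> [X]\<^bsup>k\<^esup>" for R k
    using that X by (auto simp: nsets_def N_def card_Diff_subset)
  have w_antimono: "w (Suc k) \<le> w k" if k: "k < N" for k
    unfolding w_def
  proof (rule nsets_mean_step[OF X])
    fix R assume R: "R \<in> [X]\<^bsup>k\<^esup>"
    have "(\<Sum>e\<in>X - R. of_bool (0 < f (insert e R))) \<le> (\<Sum>e\<in>X - R. of_bool (0 < f R) :: real)"
      using mono[OF size(1)[OF R]] by (intro sum_mono) (fastforce simp: of_bool_def)
    then show "(\<Sum>e\<in>X - R. of_bool (0 < f (insert e R))) \<le> real (card X - k) * of_bool (0 < f R)"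
      using size(2)[OF R] by (simp add: N_def)
  qed (use k N_def in simp)
  have u_step: "u (Suc k) \<le> u k - q / N * w k" if k: "k < N" for k
  proof -
    have "u (Suc k) \<le> nsets_mean X k (\<lambda>R. real (f R) - q / N * of_bool (0 < f R))"
      unfolding u_def
    proof (rule nsets_mean_step[OF X])
      fix R assume R: "R \<in> [X]\<^bsup>k\<^esup>"
      define B where "B = {e \<in> X. f (insert e R) < f R}"
      have B: "B \<subseteq> X - R"
        by (auto simp: B_def insert_absorb)
      have "real (f (insert e R)) \<le> real (f R) - of_bool (e \<in> B)" if "e \<in> X - R" for e
        using mono[OF size(1)[OF R], of e] that by (auto simp: B_def)
      then have "(\<Sum>e\<in>X - R. real (f (insert e R))) \<le> (\<Sum>e\<in>X - R. real (f R) - of_bool (e \<in> B))"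
        by (rule sum_mono)
      also have "\<dots> = real (N - k) * real (f R) - (\<Sum>e\<in>X - R. of_bool (e \<in> B))"
        using size(2)[OF R] by (simp add: sum_subtractf)
      also have "(\<Sum>e\<in>X - R. of_bool (e \<in> B)) = real (card B)"
        using X B by (simp add: Int_absorb1 sum_of_bool_eq)
      finally have sum_le: "(\<Sum>e\<in>X - R. real (f (insert e R))) \<le> real (N - k) * real (f R) - real (card B)" .
      have "real (N - k) * (q / N * of_bool (0 < f R)) \<le> real (card B)"
      proof (cases "0 < f R")
        case True
        have "real (N - k) / N \<le> 1"
          by (cases "N = 0") (auto simp: divide_le_eq_1)
        then have "real (N - k) / N * q \<le> q"
          using q mult_right_mono by fastforce
        then show ?thesis
          using boost[OF size(1)[OF R] True] True by (simp add: B_def)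
      qed simp
      with sum_le show "(\<Sum>e\<in>X - R. real (f (insert e R)))
          \<le> real (card X - k) * (real (f R) - q / N * of_bool (0 < f R))"
        unfolding N_def by (simp only: right_diff_distrib)
    qed (use k N_def in simp)
    also have "\<dots> = u k - q / N * w k"
      by (simp only: nsets_mean_def u_def w_def sum_subtractf diff_divide_distrib
          sum_distrib_left[symmetric] times_divide_eq_right)
    finally show ?thesis .
  qed
  have "k \<le> N \<Longrightarrow> u k \<le> f {} - q / N * k * w k" for k
  proof (induction k)
    case 0
    show ?case by (simp add: u_def nsets_mean_def)
  next
    case (Suc k)
    have "q / N * Suc k * w (Suc k) \<le> q / N * Suc k * w k"
      using q w_antimono[of k] Suc.prems by (intro mult_left_mono) auto
    moreover have "q / N * Suc k * w k = q / N * k * w k + q / N * w k"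
      by (simp add: algebra_simps add_divide_distrib)
    ultimately show ?case
      using u_step[OF Suc_le_lessD[OF Suc.prems]] Suc.IH[OF Suc_leD[OF Suc.prems]] by linarith
  qed
  moreover have "0 \<le> u m"
    unfolding u_def nsets_mean_def by (intro divide_nonneg_nonneg sum_nonneg) auto
  ultimately have le: "q / N * m * w m \<le> f {}"
    using m by (fastforce simp: N_def)
  have card: "card ([X]\<^bsup>m\<^esup>) = N choose m"
    by (simp add: N_def)
  have "[X]\<^bsup>m\<^esup> \<noteq> {}"
    using m by (auto simp: nsets_eq_empty_iff)
  moreover have "finite ([X]\<^bsup>m\<^esup>)"
    using X by (rule finite_imp_finite_nsets)
  ultimately have "measure_pmf.prob (pmf_of_set ([X]\<^bsup>m\<^esup>)) {R. 0 < f R} = w m"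
    by (simp add: measure_pmf_of_set w_def nsets_mean_def card N_def[symmetric] sum_of_bool_eq Int_def)
  moreover have "q * m * w m \<le> f {} * N"
  proof (cases "N = 0")
    case True
    then show ?thesis using m by (simp add: N_def)
  next
    case False
    have "q * m * w m = q / N * m * w m * N"
      using False by simp
    also have "\<dots> \<le> f {} * real N"
      using le by (intro mult_right_mono) auto
    finally show ?thesis by simp
  qed
  ultimately show ?thesis
    by (simp add: N_def)
qed

section \<open>Random edges on top of a dense graph\<close>

lemma min_degree_le_card_neighbours:
  assumes "finite V" "E \<subseteq> [V]\<^bsup>2\<^esup>" "v \<in> V"
  shows "min_degree V E \<le> card {w \<in> V. {v, w} \<in> E}"
proof -
  have "{e \<in> E. v \<in> e} \<subseteq> (\<lambda>w. {v, w}) ` {w \<in> V. {v, w} \<in> E}"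
  proof
    fix e assume e: "e \<in> {e \<in> E. v \<in> e}"
    then obtain x y where "e = {x, y}" "x \<in> V" "y \<in> V"
      using assms(2) nsets2_E by (metis (no_types, lifting) mem_Collect_eq subsetD)
    with e show "e \<in> (\<lambda>w. {v, w}) ` {w \<in> V. {v, w} \<in> E}"
      by (auto simp: insert_commute)
  qed
  then have "degree E v \<le> card {w \<in> V. {v, w} \<in> E}"
    unfolding degree_def using assms(1) by (intro surj_card_le) auto
  moreover have "min_degree V E \<le> degree E v"
    unfolding min_degree_def using assms(1,3) by (intro Min_le) auto
  ultimately show ?thesis
    by (rule order_trans[rotated])
qed

lemma card_nsets_2_le:
  "real (card ([V]\<^bsup>2\<^esup>)) \<le> real (card V) ^ 2 / 2"
proof -
  have "card V choose 2 \<le> card V * card V div 2"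
    by (simp add: choose_two div_le_mono)
  then have "2 * (card V choose 2) \<le> card V * card V"
    by linarith
  then have "2 * real (card V choose 2) \<le> real (card V) * real (card V)"
    by (metis of_nat_le_iff of_nat_mult of_nat_numeral)
  then show ?thesis
    by (simp add: power2_eq_square)
qed

text \<open>The bound for fixed \<open>n\<close>: fewer than \<open>2/d\<close> gaps have to be closed, and by the minimum degree of
  \<open>H\<close> each random edge closes one with probability at least \<open>d\<^sup>2\<close>, whatever has been added before.\<close>
lemma prob_hamiltonian_ge:
  fixes d :: real
  assumes d: "0 < d" "d < 1 / 2" and H: "H \<in> graphs_min_degree n d"
    and alpha: "1 \<le> independence_number {1..n} H" "independence_number {1..n} H < d\<^sup>2 * n / 2"
    and m: "0 < m" "m \<le> card (non_edges {1..n} H)"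
  shows "1 - 2 / (m * d ^ 3)
    \<le> measure_pmf.prob (random_edges {1..n} H m) {R. hamiltonian {1..n} (H \<union> R)}"
proof -
  define V where "V = {1..n}"
  define X where "X = non_edges V H"
  define M where "M = random_edges V H m"
  define D where "D = min_degree V H"
  define f where "f R = deficiency V (H \<union> R)" for R
  have V: "finite V" "card V = n"
    by (simp_all add: V_def)
  have HV: "H \<subseteq> [V]\<^bsup>2\<^esup>" and D: "d * n \<le> D"
    using H by (auto simp: graphs_min_degree_def V_def D_def)
  have deg: "D \<le> card {w \<in> V. {v, w} \<in> H}" if "v \<in> V" for v
    unfolding D_def using V(1) HV that by (rule min_degree_le_card_neighbours)
  have X: "finite X" "X \<subseteq> [V]\<^bsup>2\<^esup>"
    using V by (auto simp: X_def non_edges_def finite_imp_finite_nsets)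
  have "d\<^sup>2 \<le> (1 / 2)\<^sup>2"
    using d by (intro power_mono) auto
  then have "d\<^sup>2 * n / 2 \<le> n / 8"
    using mult_right_mono[of "d\<^sup>2" "1 / 4" "real n"] by (simp add: power2_eq_square)
  with alpha have n3: "3 \<le> n"
    by linarith
  have "(d * n)\<^sup>2 / 2 * m * measure_pmf.prob M {R. 0 < f R} \<le> f {} * card X"
    unfolding M_def random_edges_def X_def[symmetric]
  proof (rule random_hitting_bound)
    show "f (insert e R) \<le> f R" for R e
      unfolding f_def by (rule deficiency_antimono[OF V(1)]) auto
    show "(d * n)\<^sup>2 / 2 \<le> card {e \<in> X. f (insert e R) < f R}" if R: "R \<subseteq> X" "0 < f R" for R
    proof -
      have "D * D \<le> 2 * card (boosters V (H \<union> R))"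
      proof (rule many_boosters[OF V(1)])
        show "D \<le> card {w \<in> V. {v, w} \<in> H \<union> R}" if "v \<in> V" for v
          by (rule order_trans[OF deg[OF that]]) (use V(1) in \<open>auto intro!: card_mono\<close>)
      qed (use R HV X(2) f_def in auto)
      moreover have "boosters V (H \<union> R) \<subseteq> {e \<in> X. f (insert e R) < f R}"
        by (auto simp: boosters_def X_def non_edges_def f_def insert_absorb)
      then have "card (boosters V (H \<union> R)) \<le> card {e \<in> X. f (insert e R) < f R}"
        using X(1) by (intro card_mono) auto
      ultimately have "real (D * D) \<le> real (2 * card {e \<in> X. f (insert e R) < f R})"
        unfolding of_nat_le_iff by linarith
      moreover have "(d * n)\<^sup>2 \<le> real (D * D)"
        using D d mult_mono[OF D D] by (simp add: power2_eq_square)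
      ultimately show ?thesis
        by simp
    qed
  qed (use X(1) m in \<open>auto simp: X_def V_def\<close>)
  also have "\<dots> \<le> 2 / d * (n\<^sup>2 / 2)"
  proof -
    have "real (f {}) < 2 / d"
      using deficiency_less[OF V(1) HV d deg] D alpha(2) V(2) by (simp add: f_def V_def)
    moreover have "real (card X) \<le> n\<^sup>2 / 2"
    proof -
      have "card X \<le> card ([V]\<^bsup>2\<^esup>)"
        using V(1) X(2) by (intro card_mono finite_imp_finite_nsets)
      then show ?thesis
        using card_nsets_2_le[of V] V(2) by simp
    qed
    ultimately have "real (f {}) * real (card X) \<le> 2 / d * (n\<^sup>2 / 2)"
      using d by (intro mult_mono) auto
    then show ?thesis by simp
  qed
  finally have le: "(d * n)\<^sup>2 / 2 * m * measure_pmf.prob M {R. 0 < f R} \<le> 2 / d * (n\<^sup>2 / 2)" .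
  have fail: "measure_pmf.prob M {R. 0 < f R} \<le> 2 / (m * d ^ 3)"
  proof -
    define p where "p = measure_pmf.prob M {R. 0 < f R}"
    have "(real n)\<^sup>2 * (p * (m * d ^ 3)) = 2 * d * ((d * n)\<^sup>2 / 2 * m * p)"
      by (simp add: power2_eq_square power3_eq_cube)
    also have "\<dots> \<le> 2 * d * (2 / d * (n\<^sup>2 / 2))"
      using le d(1) unfolding p_def by (intro mult_left_mono) auto
    also have "\<dots> = (real n)\<^sup>2 * 2"
      using d(1) by simp
    finally have "p * (m * d ^ 3) \<le> 2"
      using n3 by (simp only: mult_le_cancel_left_pos zero_less_power of_nat_0_less_iff)
    then show ?thesis
      using d(1) m(1) unfolding p_def[symmetric] by (subst pos_le_divide_eq) simp_all
  qed
  have "1 - measure_pmf.prob M {R. 0 < f R} = measure_pmf.prob M (- {R. 0 < f R})"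
    by (subst measure_pmf.prob_compl[symmetric]) (auto simp: Compl_eq_Diff_UNIV)
  also have "\<dots> \<le> measure_pmf.prob M {R. hamiltonian V (H \<union> R)}"
    using hamiltonian_if_deficiency_0[OF V(1)] n3 V(2)
    by (intro measure_pmf.finite_measure_mono) (auto simp: f_def)
  finally show ?thesis
    using fail by (simp add: M_def V_def)
qed

theorem theorem2:
  fixes d :: "nat \<Rightarrow> real" and H :: "nat \<Rightarrow> nat set set" and m :: "nat \<Rightarrow> nat"
  assumes "\<forall>\<^sub>F n in sequentially. 0 < d n \<and> d n < 1 / 2"
    and "\<forall>\<^sub>F n in sequentially. H n \<in> graphs_min_degree n (d n)"
    and "\<forall>\<^sub>F n in sequentially. 1 \<le> independence_number {1..n} (H n)"
    and "\<forall>\<^sub>F n in sequentially.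
           real (independence_number {1..n} (H n)) < (d n)\<^sup>2 * real n / 2"
    and "\<forall>\<^sub>F n in sequentially. m n \<le> card (non_edges {1..n} (H n))"
    and "filterlim (\<lambda>n. real (m n) * d n ^ 3 / ln (inverse (d n))) at_top sequentially"
  shows "whp (\<lambda>n. random_edges {1..n} (H n) (m n)) (\<lambda>n R. hamiltonian {1..n} (H n \<union> R))"
  unfolding whp_def
proof (rule tendsto_sandwich)
  let ?t = "\<lambda>n. real (m n) * d n ^ 3"
  have pos: "\<forall>\<^sub>F n in sequentially. 0 < ?t n / ln (inverse (d n))"
    using assms(6) by (simp only: filterlim_at_top_dense)
  have at_top: "filterlim ?t at_top sequentially"
  proof (rule filterlim_at_top_mono)
    \<comment> \<open>As \<open>d < 1/2\<close>, the logarithm is bounded below by \<open>ln 2\<close>.\<close>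
    show "filterlim (\<lambda>n. ln 2 * (?t n / ln (inverse (d n)))) at_top sequentially"
      by (rule filterlim_tendsto_pos_mult_at_top[OF tendsto_const _ assms(6)]) simp
    show "\<forall>\<^sub>F n in sequentially. ln 2 * (?t n / ln (inverse (d n))) \<le> ?t n"
      using assms(1) pos
    proof eventually_elim
      case (elim n)
      have "2 \<le> inverse (d n)"
        using elim(1) by (simp add: field_simps)
      then have ln: "ln 2 \<le> ln (inverse (d n))"
        using elim(1) by (subst ln_le_cancel_iff) auto
      have "0 < ln (2 :: real)"
        by simp
      then have pos': "0 < ln (inverse (d n))"
        using ln by (rule less_le_trans)
      have "ln 2 * (?t n / ln (inverse (d n))) \<le> ln (inverse (d n)) * (?t n / ln (inverse (d n)))"
        using mult_right_mono[OF ln less_imp_le[OF elim(2)]] .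
      also have "\<dots> = ?t n"
        using pos' by (simp del: ln_inverse)
      finally show ?case .
    qed
  qed
  then have "(\<lambda>n. 2 / ?t n) \<longlonglongrightarrow> 0"
    by (intro tendsto_divide_0[OF tendsto_const] filterlim_at_top_imp_at_infinity)
  from tendsto_diff[OF tendsto_const[of 1] this] show "(\<lambda>n. 1 - 2 / ?t n) \<longlonglongrightarrow> 1"
    by simp
  show "\<forall>\<^sub>F n in sequentially. 1 - 2 / ?t n
      \<le> measure_pmf.prob (random_edges {1..n} (H n) (m n)) {R. hamiltonian {1..n} (H n \<union> R)}"
    using assms(1-5) pos
  proof eventually_elim
    case (elim n)
    have "m n \<noteq> 0"
      using elim(6) by (intro notI) simp
    then show ?case
      using elim(1-5) by (intro prob_hamiltonian_ge) simp_all
  qed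
  show "\<forall>\<^sub>F n in sequentially.
      measure_pmf.prob (random_edges {1..n} (H n) (m n)) {R. hamiltonian {1..n} (H n \<union> R)} \<le> 1"
    by (intro always_eventually allI measure_pmf.prob_le_1)
qed (rule tendsto_const)

end
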